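(* Let $(X,d)$ be a compact metric space, let $\phi:\mathbb{R}_0^+\times X\to X$ be a semiflow (not necessarily continuous) and let $\tau$ be an admissible function on $X$. Then $$\hat{h}_{\mathrm r}(\phi)\leq \hat{h}_{\mathrm s}(\phi)\leq h^{\tau}_{\mathrm{top}}(\phi).$$
   Context: A semiflow on $X$ is a map $\phi:\mathbb{R}_0^+\times X\to X$, $\phi_t(x)=\phi(t,x)$, with $\phi_0=\mathrm{id}$ and $\phi_{s+t}=\phi_s\circ\phi_t$; it need not be continuous. Definition of $\hat h_{\mathrm r},\hat h_{\mathrm s}$. For $\delta>0$ put $d_\delta^\phi(x,y)=\inf\{d(\phi_s(x),\phi_s(y)):s\in[0,\delta)\}$. For $x\in X$, $\varepsilon,T,\delta>0$ put $\hat B(x,\phi,T,\varepsilon,\delta)=\{y\in X: d_\delta^\phi(\phi_t(x),\phi_t(y))<\varepsilon \text{ for all } t\in[0,T]\}$. A set $F\subseteq X$ is $(\phi,T,\varepsilon,\delta)$-spanning if $X\subset\bigcup_{y\in F}\hat B(y,\phi,T,\varepsilon,\delta)$; a set $E\subseteq X$ is $(\phi,T,\varepsilon,\delta)$-separated if $E\cap\hat B(x,\phi,T,\varepsilon,\delta)=\{x\}$ for all $x\in E$. Let $\hat r(\phi,T,\varepsilon,\delta)=\inf\{|F|:F\text{ is }(\phi,T,\varepsilon,\delta)\text{-spanning}\}$ and $\hat s(\phi,T,\varepsilon,\delta)=\sup\{|E|:E\text{ is }(\phi,T,\varepsilon,\delta)\text{-separated}\}$ (possibly $\infty$, with $\log\infty=\infty$).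 Define $$\hat h_{\mathrm r}(\phi)=\lim_{\delta\to0^+}\lim_{\varepsilon\to0^+}\limsup_{T\to+\infty}\tfrac1T\log\hat r(\phi,T,\varepsilon,\delta),\qquad \hat h_{\mathrm s}(\phi)=\lim_{\delta\to0^+}\lim_{\varepsilon\to0^+}\limsup_{T\to+\infty}\tfrac1T\log\hat s(\phi,T,\varepsilon,\delta)$$ (the limits exist in $[0,\infty]$ by monotonicity). Admissible functions. Here $\mathbb N=\{1,2,\dots\}$ and $\mathbb N_0=\mathbb N\cup\{0\}$. Let $\tau$ be a function assigning to each $x\in X$ a strictly increasing sequence $(\tau_n(x))_{n\in A_0(x)}$ of nonnegative numbers, where either $A_0(x)=\{0,1,\dots,l\}$ for some $l\in\mathbb N$ or $A_0(x)=\mathbb N_0$, with $\tau_0(x)=0$ for all $x$. It is admissible with respect to $Z\subset X$ if there is a constant $\gamma>0$ such that (1) $\tau_1(x)\ge\gamma$ for all $x\in Z$, and for all $x\in X$ and all $n\in\mathbb N$ with $n+1\in A_0(x)$: (2) $\tau_{n+1}(x)-\tau_n(x)\ge\gamma$; (3) $\tau_1(\phi_s(x))=\tau_n(x)-s$ if $\tau_{n-1}(x)<s<\tau_n(x)$; (4) $\tau_1(\phi_s(x))=\tau_{n+1}(x)-s$ if $s=\tau_n(x)$. An admissible function on $X$ is one that is admissible with respect to some subset $Z\subset X$. $\tau$-entropy. For $T>0$ and $0<\rho<\gamma/2$ put $J^\tau_{T,\rho}(x)=(0,T]\setminus\bigcup_{j\in A_0(x)}(\tau_j(x)-\rho,\tau_j(x)+\rho)$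 and $B^\tau(x,\phi,T,\epsilon,\rho)=\{y\in X:d(\phi_t(x),\phi_t(y))<\epsilon\text{ for all }t\in J^\tau_{T,\rho}(x)\}$. A finite set $E\subseteq X$ is $(\phi,\tau,T,\epsilon,\rho)$-separated if $E\cap B^\tau(x,\phi,T,\epsilon,\rho)=\{x\}$ for all $x\in E$. With $s^\tau(\phi,T,\epsilon,\rho)=\sup\{|E|:E\text{ is }(\phi,\tau,T,\epsilon,\rho)\text{-separated}\}$, define $$h^\tau_{\mathrm{top}}(\phi)=\lim_{\rho\to0^+}\lim_{\epsilon\to0^+}\limsup_{T\to+\infty}\tfrac1T\log s^\tau(\phi,T,\epsilon,\rho).$$ *)

theory Defs
  imports "HOL-Analysis.Analysis"
begin

text \<open>
  The space is a set \<open>X\<close> in a metric space type, with the metric \<open>dist\<close>.  A semiflow is a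
  function on \<open>real\<close> of which only the values at times \<open>t \<ge> 0\<close> and at points of \<open>X\<close> matter.
\<close>

definition semiflow_on :: "'a set \<Rightarrow> (real \<Rightarrow> 'a \<Rightarrow> 'a) \<Rightarrow> bool" where
  "semiflow_on X \<phi> \<longleftrightarrow>
     (\<forall>t\<ge>0. \<forall>x\<in>X. \<phi> t x \<in> X) \<and>
     (\<forall>x\<in>X. \<phi> 0 x = x) \<and>
     (\<forall>s\<ge>0. \<forall>t\<ge>0. \<forall>x\<in>X. \<phi> (s + t) x = \<phi> s (\<phi> t x))"

definition ecard :: "'a set \<Rightarrow> enat" where
  "ecard A = (if finite A then enat (card A) else \<infinity>)"

text \<open>Logarithm of an extended cardinality; the value at \<open>0\<close> only matters when \<open>X\<close> is empty.\<close>

definition elog :: "enat \<Rightarrow> ereal" where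
  "elog k = (case k of enat n \<Rightarrow> (if n = 0 then - \<infinity> else ereal (ln (real n))) | \<infinity> \<Rightarrow> \<infinity>)"

definition growth_rate :: "(real \<Rightarrow> enat) \<Rightarrow> ereal" where
  "growth_rate N = Limsup at_top (\<lambda>T. ereal (1 / T) * elog (N T))"


definition dist_delta ::
    "(real \<Rightarrow> 'a \<Rightarrow> 'a::metric_space) \<Rightarrow> real \<Rightarrow> 'a \<Rightarrow> 'a \<Rightarrow> real" where
  "dist_delta \<phi> \<delta> x y = (INF s\<in>{0..<\<delta>}. dist (\<phi> s x) (\<phi> s y))"

definition hat_ball ::
    "'a set \<Rightarrow> (real \<Rightarrow> 'a \<Rightarrow> 'a::metric_space) \<Rightarrow> real \<Rightarrow> real \<Rightarrow> real \<Rightarrow> 'a \<Rightarrow> 'a set" where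
  "hat_ball X \<phi> T \<epsilon> \<delta> x = {y \<in> X. \<forall>t\<in>{0..T}. dist_delta \<phi> \<delta> (\<phi> t x) (\<phi> t y) < \<epsilon>}"

definition hat_spanning ::
    "'a set \<Rightarrow> (real \<Rightarrow> 'a \<Rightarrow> 'a::metric_space) \<Rightarrow> real \<Rightarrow> real \<Rightarrow> real \<Rightarrow> 'a set \<Rightarrow> bool" where
  "hat_spanning X \<phi> T \<epsilon> \<delta> F \<longleftrightarrow> F \<subseteq> X \<and> X \<subseteq> (\<Union>y\<in>F. hat_ball X \<phi> T \<epsilon> \<delta> y)"

definition hat_separated ::
    "'a set \<Rightarrow> (real \<Rightarrow> 'a \<Rightarrow> 'a::metric_space) \<Rightarrow> real \<Rightarrow> real \<Rightarrow> real \<Rightarrow> 'a set \<Rightarrow> bool" where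
  "hat_separated X \<phi> T \<epsilon> \<delta> E \<longleftrightarrow> E \<subseteq> X \<and> (\<forall>x\<in>E. E \<inter> hat_ball X \<phi> T \<epsilon> \<delta> x = {x})"

definition hat_r ::
    "'a set \<Rightarrow> (real \<Rightarrow> 'a \<Rightarrow> 'a::metric_space) \<Rightarrow> real \<Rightarrow> real \<Rightarrow> real \<Rightarrow> enat" where
  "hat_r X \<phi> T \<epsilon> \<delta> = (INF F\<in>{F. hat_spanning X \<phi> T \<epsilon> \<delta> F}. ecard F)"

definition hat_s ::
    "'a set \<Rightarrow> (real \<Rightarrow> 'a \<Rightarrow> 'a::metric_space) \<Rightarrow> real \<Rightarrow> real \<Rightarrow> real \<Rightarrow> enat" where
  "hat_s X \<phi> T \<epsilon> \<delta> = (SUP E\<in>{E. hat_separated X \<phi> T \<epsilon> \<delta> E}. ecard E)"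

text \<open>
  In the three entropies the operator \<open>Lim\<close> is applied to functions that are antimonotone on the
  positive reals, so all the one-sided limits exist in \<open>ereal\<close>.
\<close>

definition hat_h_r :: "'a set \<Rightarrow> (real \<Rightarrow> 'a \<Rightarrow> 'a::metric_space) \<Rightarrow> ereal" where
  "hat_h_r X \<phi> =
     Lim (at_right 0) (\<lambda>\<delta>. Lim (at_right 0) (\<lambda>\<epsilon>. growth_rate (\<lambda>T. hat_r X \<phi> T \<epsilon> \<delta>)))"

definition hat_h_s :: "'a set \<Rightarrow> (real \<Rightarrow> 'a \<Rightarrow> 'a::metric_space) \<Rightarrow> ereal" where
  "hat_h_s X \<phi> =
     Lim (at_right 0) (\<lambda>\<delta>. Lim (at_right 0) (\<lambda>\<epsilon>. growth_rate (\<lambda>T. hat_s X \<phi> T \<epsilon> \<delta>)))"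


text \<open>
  A family of finite or infinite sequences is a pair of the index sets \<open>A x\<close> and a function
  \<open>\<tau>\<close> of which only the values \<open>\<tau> x n\<close> with \<open>n \<in> A x\<close> matter.  Every index set contains \<open>0\<close> and
  \<open>1\<close>, so \<open>\<tau> x 1\<close> is always meaningful.
\<close>

definition time_sequences :: "'a set \<Rightarrow> ('a \<Rightarrow> nat set) \<Rightarrow> ('a \<Rightarrow> nat \<Rightarrow> real) \<Rightarrow> bool" where
  "time_sequences X A \<tau> \<longleftrightarrow>
     (\<forall>x\<in>X. ((\<exists>l\<ge>1. A x = {0..l}) \<or> A x = UNIV) \<and>
            strict_mono_on (A x) (\<tau> x) \<and> (\<forall>n\<in>A x. 0 \<le> \<tau> x n) \<and> \<tau> x 0 = 0)"

definition admissible_wrt ::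
    "'a set \<Rightarrow> (real \<Rightarrow> 'a \<Rightarrow> 'a) \<Rightarrow> ('a \<Rightarrow> nat set) \<Rightarrow> ('a \<Rightarrow> nat \<Rightarrow> real) \<Rightarrow> 'a set \<Rightarrow> bool" where
  "admissible_wrt X \<phi> A \<tau> Z \<longleftrightarrow>
     time_sequences X A \<tau> \<and>
     (\<exists>\<gamma>>0. (\<forall>x\<in>Z. \<tau> x 1 \<ge> \<gamma>) \<and>
       (\<forall>x\<in>X. \<forall>n\<ge>1. n + 1 \<in> A x \<longrightarrow>
          \<tau> x (n + 1) - \<tau> x n \<ge> \<gamma> \<and>
          (\<forall>s. \<tau> x (n - 1) < s \<and> s < \<tau> x n \<longrightarrow> \<tau> (\<phi> s x) 1 = \<tau> x n - s) \<and>
          (\<forall>s. s = \<tau> x n \<longrightarrow> \<tau> (\<phi> s x) 1 = \<tau> x (n + 1) - s)))"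

definition admissible_on ::
    "'a set \<Rightarrow> (real \<Rightarrow> 'a \<Rightarrow> 'a) \<Rightarrow> ('a \<Rightarrow> nat set) \<Rightarrow> ('a \<Rightarrow> nat \<Rightarrow> real) \<Rightarrow> bool" where
  "admissible_on X \<phi> A \<tau> \<longleftrightarrow> (\<exists>Z\<subseteq>X. admissible_wrt X \<phi> A \<tau> Z)"

definition tau_times ::
    "('a \<Rightarrow> nat set) \<Rightarrow> ('a \<Rightarrow> nat \<Rightarrow> real) \<Rightarrow> real \<Rightarrow> real \<Rightarrow> 'a \<Rightarrow> real set" where
  "tau_times A \<tau> T \<rho> x = {0<..T} - (\<Union>j\<in>A x. {\<tau> x j - \<rho> <..< \<tau> x j + \<rho>})"

definition tau_ball ::
    "'a set \<Rightarrow> (real \<Rightarrow> 'a \<Rightarrow> 'a::metric_space) \<Rightarrow> ('a \<Rightarrow> nat set) \<Rightarrow> ('a \<Rightarrow> nat \<Rightarrow> real) \<Rightarrow>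
     real \<Rightarrow> real \<Rightarrow> real \<Rightarrow> 'a \<Rightarrow> 'a set" where
  "tau_ball X \<phi> A \<tau> T \<epsilon> \<rho> x =
     {y \<in> X. \<forall>t\<in>tau_times A \<tau> T \<rho> x. dist (\<phi> t x) (\<phi> t y) < \<epsilon>}"

definition tau_separated ::
    "'a set \<Rightarrow> (real \<Rightarrow> 'a \<Rightarrow> 'a::metric_space) \<Rightarrow> ('a \<Rightarrow> nat set) \<Rightarrow> ('a \<Rightarrow> nat \<Rightarrow> real) \<Rightarrow>
     real \<Rightarrow> real \<Rightarrow> real \<Rightarrow> 'a set \<Rightarrow> bool" where
  "tau_separated X \<phi> A \<tau> T \<epsilon> \<rho> E \<longleftrightarrow>
     finite E \<and> E \<subseteq> X \<and> (\<forall>x\<in>E. E \<inter> tau_ball X \<phi> A \<tau> T \<epsilon> \<rho> x = {x})"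

definition tau_s ::
    "'a set \<Rightarrow> (real \<Rightarrow> 'a \<Rightarrow> 'a::metric_space) \<Rightarrow> ('a \<Rightarrow> nat set) \<Rightarrow> ('a \<Rightarrow> nat \<Rightarrow> real) \<Rightarrow>
     real \<Rightarrow> real \<Rightarrow> real \<Rightarrow> enat" where
  "tau_s X \<phi> A \<tau> T \<epsilon> \<rho> = (SUP E\<in>{E. tau_separated X \<phi> A \<tau> T \<epsilon> \<rho> E}. ecard E)"

text \<open>
  The restriction \<open>\<rho> < \<gamma> / 2\<close>, with \<open>\<gamma>\<close> the admissibility constant, plays no role in the limit
  as \<open>\<rho>\<close> tends to \<open>0\<close> from the right, so \<open>\<gamma>\<close> is not a parameter.
\<close>

definition h_tau ::
    "'a set \<Rightarrow> (real \<Rightarrow> 'a \<Rightarrow> 'a::metric_space) \<Rightarrow> ('a \<Rightarrow> nat set) \<Rightarrow> ('a \<Rightarrow> nat \<Rightarrow> real) \<Rightarrow>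
     ereal" where
  "h_tau X \<phi> A \<tau> =
     Lim (at_right 0) (\<lambda>\<rho>. Lim (at_right 0) (\<lambda>\<epsilon>. growth_rate (\<lambda>T. tau_s X \<phi> A \<tau> T \<epsilon> \<rho>)))"

end

theory Submission
  imports Defs
begin

text \<open>
  The first inequality holds because a separated set of maximal cardinality is spanning.

  For the second one, fix \<open>\<delta>\<close> and let \<open>\<rho>\<close> be small compared with \<open>\<delta>\<close> and with the admissibility
  constant.  The times \<open>\<tau> x j\<close> with \<open>j \<ge> 1\<close> are far apart, so at most two of the excluded
  intervals, one around \<open>\<tau> x 0 = 0\<close> and one around a single \<open>\<tau> x j\<close> with \<open>j \<ge> 1\<close>, meet the
  three times \<open>t\<close>, \<open>t + 2\<rho>\<close>, \<open>t + 4\<rho>\<close>, and each of them contains at most one of these times.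
  Hence \<open>{t..<t + \<delta>}\<close> contains an admitted time.  If \<open>dist_delta\<close> separates two orbits at
  time \<open>t\<close>, the orbits are apart on the whole of \<open>{t..<t + \<delta>}\<close>, in particular at that time.
  So sets separated up to time \<open>T\<close> in the first sense are separated up to time \<open>T + \<delta>\<close> in the
  second sense, and the shift of \<open>T\<close> does not affect the exponential growth rate.
\<close>

section \<open>One-sided limits of antimonotone functions as suprema\<close>

text \<open>Such a function grows as its argument decreases to 0, so it converges to its supremum.
  \<open>Lim\<close> is a definite description, whose value is known only once convergence is
  proved.\<close>

lemma Lim_at_right_0_antimono:
  fixes f :: "real \<Rightarrow> ereal"
  assumes anti: "\<And>a b. 0 < a \<Longrightarrow> a \<le> b \<Longrightarrow> f b \<le> f a"
  shows "Lim (at_right 0) f = (SUP a\<in>{0<..}. f a)"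
proof -
  have "(f \<longlongrightarrow> (SUP a\<in>{0<..}. f a)) (at_right 0)"
  proof (rule increasing_tendsto)
    show "\<forall>\<^sub>F a in at_right 0. f a \<le> (SUP a\<in>{0<..}. f a)"
      by (auto intro!: eventually_at_rightI[of 0 1] SUP_upper)
  next
    fix y assume "y < (SUP a\<in>{0<..}. f a)"
    then obtain b where b: "0 < b" "y < f b"
      by (auto simp: less_SUP_iff)
    show "\<forall>\<^sub>F a in at_right 0. y < f a"
      using b by (auto intro!: eventually_at_rightI[of 0 b] less_le_trans[OF _ anti[of _ b]])
  qed
  then show ?thesis
    by (intro tendsto_Lim) auto
qed

text \<open>The inner suprema inherit antimonotonicity in the outer parameter termwise, so the
  one-variable result applies twice.\<close>

lemma Lim_Lim_at_right_0_antimono: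
  fixes g :: "real \<Rightarrow> real \<Rightarrow> ereal"
  assumes anti1: "\<And>a b e. 0 < a \<Longrightarrow> a \<le> b \<Longrightarrow> 0 < e \<Longrightarrow> g b e \<le> g a e"
    and anti2: "\<And>a e f. 0 < a \<Longrightarrow> 0 < e \<Longrightarrow> e \<le> f \<Longrightarrow> g a f \<le> g a e"
  shows "Lim (at_right 0) (\<lambda>a. Lim (at_right 0) (g a)) = (SUP a\<in>{0<..}. SUP e\<in>{0<..}. g a e)"
proof -
  have inner: "Lim (at_right 0) (g a) = (SUP e\<in>{0<..}. g a e)" if "0 < a" for a
    by (intro Lim_at_right_0_antimono anti2 that)
  have "Lim (at_right 0) (\<lambda>a. Lim (at_right 0) (g a)) = (SUP a\<in>{0<..}. Lim (at_right 0) (g a))"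
  proof (rule Lim_at_right_0_antimono)
    fix a b :: real assume ab: "0 < a" "a \<le> b"
    then have "(SUP e\<in>{0<..}. g b e) \<le> (SUP e\<in>{0<..}. g a e)"
      by (intro SUP_subset_mono subset_refl anti1) auto
    then show "Lim (at_right 0) (g b) \<le> Lim (at_right 0) (g a)"
      using ab by (simp add: inner)
  qed
  also have "\<dots> = (SUP a\<in>{0<..}. SUP e\<in>{0<..}. g a e)"
    by (intro SUP_cong) (auto simp: inner)
  finally show ?thesis .
qed

section \<open>Exponential growth rates\<close>

lemma elog_mono: "m \<le> n \<Longrightarrow> elog m \<le> elog n"
  by (auto simp: elog_def split: enat.split)

text \<open>If a real \<open>r\<close> lies above the growth rate of \<open>M\<close>, then
  eventually \<open>elog (N T)\<close> is at most \<open>r * (T + c)\<close>, and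
  \<open>(T + c) / T\<close> tends to 1.\<close>

lemma growth_rate_shift:
  assumes c: "0 \<le> c" and le: "\<And>T. 0 < T \<Longrightarrow> N T \<le> M (T + c)"
  shows "growth_rate N \<le> growth_rate M"
proof (rule dense_ge)
  fix x assume x: "growth_rate M < x"
  show "growth_rate N \<le> x"
  proof (cases x)
    case (real r)
    have "\<forall>\<^sub>F T in at_top. ereal (1 / T) * elog (M T) < ereal r"
      using x real unfolding growth_rate_def by (auto dest: Limsup_lessD)
    then obtain T0 where T0: "\<And>T. T0 \<le> T \<Longrightarrow> ereal (1 / T) * elog (M T) < ereal r"
      by (auto simp: eventually_at_top_linorder)
    have bound: "ereal (1 / T) * elog (N T) \<le> ereal (r * (T + c) / T)" if T: "max 1 T0 \<le> T" for T
    proof -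
      have less: "ereal (1 / (T + c)) * elog (M (T + c)) < ereal r"
        using T c by (intro T0) auto
      have "elog (M (T + c)) \<le> ereal (r * (T + c))"
        using less T c by (cases "elog (M (T + c))") (auto simp: field_simps)
      with elog_mono[OF le[of T]] T have "elog (N T) \<le> ereal (r * (T + c))"
        by auto
      then have "ereal (1 / T) * elog (N T) \<le> ereal (1 / T) * ereal (r * (T + c))"
        using T by (intro ereal_mult_left_mono) auto
      then show ?thesis
        by simp
    qed
    have "((\<lambda>T. r + r * c * inverse T) \<longlongrightarrow> r + r * c * 0) at_top"
      by (intro tendsto_intros tendsto_inverse_0_at_top filterlim_ident)
    moreover have "\<forall>\<^sub>F T in at_top. r + r * c * inverse T = r * (T + c) / T"
      using eventually_gt_at_top[of 0] by eventually_elim (auto simp: field_simps)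
    ultimately have "((\<lambda>T. r * (T + c) / T) \<longlongrightarrow> r) at_top"
      by (auto dest: Lim_transform_eventually)
    then have "Limsup at_top (\<lambda>T. ereal (r * (T + c) / T)) = ereal r"
      by (intro lim_imp_Limsup) auto
    moreover have "growth_rate N \<le> Limsup at_top (\<lambda>T. ereal (r * (T + c) / T))"
      unfolding growth_rate_def
      by (intro Limsup_mono eventually_at_top_linorderI[of "max 1 T0"] bound)
    ultimately show ?thesis
      using real by simp
  \<comment> \<open>Only infinite \<open>x\<close> remain: plus infinity bounds everything, and
    minus infinity is strictly above nothing.\<close>
  qed (use x in auto)
qed

lemma growth_rate_mono:
  assumes "\<And>T. 0 < T \<Longrightarrow> N T \<le> M T"
  shows "growth_rate N \<le> growth_rate M"
  using growth_rate_shift[of 0 N M] assms by simp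

section \<open>Extended cardinalities\<close>

lemma ecard_mono: "F \<subseteq> E \<Longrightarrow> ecard F \<le> ecard E"
  by (auto simp: ecard_def card_mono dest: finite_subset)

text \<open>An infinite set has finite subsets of every size. This bridges the two notions of
  separation: \<open>hat_separated\<close> admits infinite sets, \<open>tau_separated\<close> only
  finite ones.\<close>

lemma ecard_le_iff_finite_subsets:
  "ecard E \<le> n \<longleftrightarrow> (\<forall>F\<subseteq>E. finite F \<longrightarrow> ecard F \<le> n)"
proof (cases "finite E")
  case True
  then show ?thesis
    by (meson ecard_mono order_refl order_trans)
next
  case False
  have "n = \<infinity>" if "\<forall>F\<subseteq>E. finite F \<longrightarrow> ecard F \<le> n"
  proof (cases n)
    case (enat k)
    obtain F where "F \<subseteq> E" "finite F" "card F = Suc k"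
      using infinite_arbitrarily_large[OF False] by metis
    then have "ecard F \<le> n"
      using that by blast
    then show ?thesis
      using \<open>finite F\<close> \<open>card F = Suc k\<close> enat by (simp add: ecard_def)
  qed simp
  then show ?thesis
    using ecard_mono order_trans by fastforce
qed

lemma Int_eq_singleton_iff:
  "x \<in> E \<Longrightarrow> x \<in> B \<Longrightarrow> E \<inter> B = {x} \<longleftrightarrow> (\<forall>y\<in>E. x \<noteq> y \<longrightarrow> y \<notin> B)"
  by (auto simp: set_eq_iff)

section \<open>Spanning and separated sets for \<open>dist_delta\<close>\<close>

lemma dist_delta_commute: "dist_delta \<phi> \<delta> x y = dist_delta \<phi> \<delta> y x"
  by (simp add: dist_delta_def dist_commute)

lemma dist_delta_self: "0 < \<delta> \<Longrightarrow> dist_delta \<phi> \<delta> x x = 0"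
  by (simp add: dist_delta_def)

lemma dist_delta_le:
  assumes "s \<in> {0..<\<delta>}"
  shows "dist_delta \<phi> \<delta> x y \<le> dist (\<phi> s x) (\<phi> s y)"
  unfolding dist_delta_def using assms by (intro cINF_lower bdd_belowI2[of _ 0]) auto

lemma dist_delta_antimono:
  assumes "0 < \<delta>'" "\<delta>' \<le> \<delta>"
  shows "dist_delta \<phi> \<delta> x y \<le> dist_delta \<phi> \<delta>' x y"
  unfolding dist_delta_def[of _ \<delta>'] using assms by (intro cINF_greatest dist_delta_le) auto

lemma hat_ball_mono:
  assumes "0 < \<delta>'" "\<delta>' \<le> \<delta>" "\<epsilon>' \<le> \<epsilon>"
  shows "hat_ball X \<phi> T \<epsilon>' \<delta>' x \<subseteq> hat_ball X \<phi> T \<epsilon> \<delta> x"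
  unfolding hat_ball_def
  by (blast intro: le_less_trans[OF dist_delta_antimono[OF assms(1,2)]] less_le_trans[OF _ assms(3)])

lemma center_in_hat_ball:
  "x \<in> X \<Longrightarrow> 0 < \<epsilon> \<Longrightarrow> 0 < \<delta> \<Longrightarrow> x \<in> hat_ball X \<phi> T \<epsilon> \<delta> x"
  by (simp add: hat_ball_def dist_delta_self)

lemma hat_ball_commute:
  "x \<in> X \<Longrightarrow> y \<in> hat_ball X \<phi> T \<epsilon> \<delta> x \<Longrightarrow> x \<in> hat_ball X \<phi> T \<epsilon> \<delta> y"
  by (simp add: hat_ball_def dist_delta_commute)

text \<open>Positive \<open>\<epsilon>\<close> and \<open>\<delta>\<close> place each point of
  \<open>X\<close> in its own ball. The pairwise form passes directly to subsets and to smaller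
  balls.\<close>

lemma hat_separated_iff:
  assumes "0 < \<epsilon>" "0 < \<delta>"
  shows "hat_separated X \<phi> T \<epsilon> \<delta> E \<longleftrightarrow>
    E \<subseteq> X \<and> (\<forall>x\<in>E. \<forall>y\<in>E. x \<noteq> y \<longrightarrow> y \<notin> hat_ball X \<phi> T \<epsilon> \<delta> x)"
proof -
  have "E \<inter> hat_ball X \<phi> T \<epsilon> \<delta> x = {x} \<longleftrightarrow> (\<forall>y\<in>E. x \<noteq> y \<longrightarrow> y \<notin> hat_ball X \<phi> T \<epsilon> \<delta> x)"
    if "x \<in> E" "E \<subseteq> X" for x
    using that assms by (intro Int_eq_singleton_iff center_in_hat_ball) auto
  then show ?thesis
    unfolding hat_separated_def by (metis (no_types, lifting))
qed

lemma hat_s_antimono: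
  assumes "0 < \<epsilon>'" "\<epsilon>' \<le> \<epsilon>" "0 < \<delta>'" "\<delta>' \<le> \<delta>"
  shows "hat_s X \<phi> T \<epsilon> \<delta> \<le> hat_s X \<phi> T \<epsilon>' \<delta>'"
proof -
  have "hat_separated X \<phi> T \<epsilon>' \<delta>' E" if "hat_separated X \<phi> T \<epsilon> \<delta> E" for E
  proof -
    have "0 < \<epsilon>" "0 < \<delta>"
      using assms by linarith+
    with that assms show ?thesis
      using hat_ball_mono[OF assms(3,4,2)] by (simp add: hat_separated_iff) blast
  qed
  then show ?thesis
    unfolding hat_s_def by (intro SUP_subset_mono) auto
qed

lemma hat_r_antimono:
  assumes "\<epsilon>' \<le> \<epsilon>" "0 < \<delta>'" "\<delta>' \<le> \<delta>"
  shows "hat_r X \<phi> T \<epsilon> \<delta> \<le> hat_r X \<phi> T \<epsilon>' \<delta>'"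
proof -
  have "hat_spanning X \<phi> T \<epsilon> \<delta> F" if "hat_spanning X \<phi> T \<epsilon>' \<delta>' F" for F
    using that hat_ball_mono[OF assms(2,3,1), of X \<phi> T] unfolding hat_spanning_def by blast
  then show ?thesis
    unfolding hat_r_def by (intro INF_superset_mono) auto
qed

text \<open>A point of \<open>X\<close> missed by all the balls could be added to \<open>E\<close>;
  symmetry of ball membership keeps the enlarged set separated.\<close>

lemma hat_spanning_of_maximal_separated:
  assumes pos: "0 < \<epsilon>" "0 < \<delta>" and E: "hat_separated X \<phi> T \<epsilon> \<delta> E"
    and maximal: "\<And>x. x \<notin> E \<Longrightarrow> \<not> hat_separated X \<phi> T \<epsilon> \<delta> (insert x E)"
  shows "hat_spanning X \<phi> T \<epsilon> \<delta> E"
proof -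
  have sub: "E \<subseteq> X"
    using E by (simp add: hat_separated_def)
  have "\<exists>y\<in>E. x \<in> hat_ball X \<phi> T \<epsilon> \<delta> y" if x: "x \<in> X" for x
  proof (rule ccontr)
    assume far: "\<not> (\<exists>y\<in>E. x \<in> hat_ball X \<phi> T \<epsilon> \<delta> y)"
    then have "x \<notin> E"
      using center_in_hat_ball[OF x pos] by blast
    moreover have "hat_separated X \<phi> T \<epsilon> \<delta> (insert x E)"
      using E far x sub hat_ball_commute[OF x] by (auto simp: hat_separated_iff[OF pos])
    ultimately show False
      using maximal by blast
  qed
  then show ?thesis
    using sub by (auto simp: hat_spanning_def)
qed

lemma hat_r_le_hat_s:
  assumes pos: "0 < \<epsilon>" "0 < \<delta>"
  shows "hat_r X \<phi> T \<epsilon> \<delta> \<le> hat_s X \<phi> T \<epsilon> \<delta>"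
proof (cases "hat_s X \<phi> T \<epsilon> \<delta>")
  case (enat n)
  have bound: "finite E \<and> card E \<le> n" if "hat_separated X \<phi> T \<epsilon> \<delta> E" for E
  proof -
    have "ecard E \<le> enat n"
      unfolding enat[symmetric] hat_s_def using that by (intro SUP_upper) auto
    then show ?thesis
      by (auto simp: ecard_def split: if_splits)
  qed
  \<comment> \<open>The empty set starts the search for a largest separated set;
    \<open>Suc n\<close> turns the bound \<open>n\<close> into the strict bound that the search
    takes.\<close>
  have "hat_separated X \<phi> T \<epsilon> \<delta> {}"
    by (simp add: hat_separated_def)
  then obtain E where E: "hat_separated X \<phi> T \<epsilon> \<delta> E"
    and largest: "\<And>E'. hat_separated X \<phi> T \<epsilon> \<delta> E' \<Longrightarrow> card E' \<le> card E"
    using ex_has_greatest_nat[of "hat_separated X \<phi> T \<epsilon> \<delta>" "{}" card "Suc n"] bound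
    by (metis le_imp_less_Suc)
  \<comment> \<open>Since \<open>E\<close> is finite, inserting a new point strictly increases
    \<open>card\<close>.\<close>
  have "\<not> hat_separated X \<phi> T \<epsilon> \<delta> (insert x E)" if "x \<notin> E" for x
    using largest[of "insert x E"] bound[OF E] that by auto
  then have "hat_spanning X \<phi> T \<epsilon> \<delta> E"
    by (intro hat_spanning_of_maximal_separated[OF pos E])
  then have "hat_r X \<phi> T \<epsilon> \<delta> \<le> ecard E"
    unfolding hat_r_def by (intro INF_lower) auto
  also have "\<dots> \<le> hat_s X \<phi> T \<epsilon> \<delta>"
    unfolding hat_s_def using E by (intro SUP_upper) auto
  finally show ?thesis .
qed simp

section \<open>Separated sets for the admissible function\<close>

lemma tau_separated_iff:
  assumes "0 < \<epsilon>"
  shows "tau_separated X \<phi> A \<tau> T \<epsilon> \<rho> E \<longleftrightarrow>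
    finite E \<and> E \<subseteq> X \<and> (\<forall>x\<in>E. \<forall>y\<in>E. x \<noteq> y \<longrightarrow> y \<notin> tau_ball X \<phi> A \<tau> T \<epsilon> \<rho> x)"
proof -
  have "x \<in> tau_ball X \<phi> A \<tau> T \<epsilon> \<rho> x" if "x \<in> X" for x
    using that assms by (simp add: tau_ball_def)
  then have "E \<inter> tau_ball X \<phi> A \<tau> T \<epsilon> \<rho> x = {x} \<longleftrightarrow>
      (\<forall>y\<in>E. x \<noteq> y \<longrightarrow> y \<notin> tau_ball X \<phi> A \<tau> T \<epsilon> \<rho> x)"
    if "x \<in> E" "E \<subseteq> X" for x
    using that by (intro Int_eq_singleton_iff) auto
  then show ?thesis
    unfolding tau_separated_def by (metis (no_types, lifting))
qed

lemma tau_ball_mono: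
  assumes "\<epsilon>' \<le> \<epsilon>" "\<rho>' \<le> \<rho>"
  shows "tau_ball X \<phi> A \<tau> T \<epsilon>' \<rho>' x \<subseteq> tau_ball X \<phi> A \<tau> T \<epsilon> \<rho> x"
proof -
  have "tau_times A \<tau> T \<rho> x \<subseteq> tau_times A \<tau> T \<rho>' x"
    using assms(2) unfolding tau_times_def by (intro Diff_mono UN_mono
        greaterThanLessThan_subseteq_greaterThanLessThan[THEN iffD2]) auto
  then show ?thesis
    unfolding tau_ball_def by (blast intro: less_le_trans[OF _ assms(1)])
qed

lemma tau_s_antimono:
  assumes "0 < \<epsilon>'" "\<epsilon>' \<le> \<epsilon>" "\<rho>' \<le> \<rho>"
  shows "tau_s X \<phi> A \<tau> T \<epsilon> \<rho> \<le> tau_s X \<phi> A \<tau> T \<epsilon>' \<rho>'"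
proof -
  have "tau_separated X \<phi> A \<tau> T \<epsilon>' \<rho>' E" if "tau_separated X \<phi> A \<tau> T \<epsilon> \<rho> E" for E
  proof -
    have "0 < \<epsilon>"
      using assms by linarith
    with that assms show ?thesis
      using tau_ball_mono[OF assms(2,3)] by (simp add: tau_separated_iff) blast
  qed
  then show ?thesis
    unfolding tau_s_def by (intro SUP_subset_mono) auto
qed

section \<open>The three entropies as iterated suprema\<close>

lemma hat_h_r_eq_SUP:
  "hat_h_r X \<phi> = (SUP \<delta>\<in>{0<..}. SUP \<epsilon>\<in>{0<..}. growth_rate (\<lambda>T. hat_r X \<phi> T \<epsilon> \<delta>))"
  unfolding hat_h_r_def
  by (intro Lim_Lim_at_right_0_antimono growth_rate_mono hat_r_antimono) auto

lemma hat_h_s_eq_SUP: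
  "hat_h_s X \<phi> = (SUP \<delta>\<in>{0<..}. SUP \<epsilon>\<in>{0<..}. growth_rate (\<lambda>T. hat_s X \<phi> T \<epsilon> \<delta>))"
  unfolding hat_h_s_def
  by (intro Lim_Lim_at_right_0_antimono growth_rate_mono hat_s_antimono) auto

lemma h_tau_eq_SUP:
  "h_tau X \<phi> A \<tau> = (SUP \<rho>\<in>{0<..}. SUP \<epsilon>\<in>{0<..}. growth_rate (\<lambda>T. tau_s X \<phi> A \<tau> T \<epsilon> \<rho>))"
  unfolding h_tau_def
  by (intro Lim_Lim_at_right_0_antimono growth_rate_mono tau_s_antimono) auto

text \<open>The gap between the times of index \<open>0\<close> and \<open>1\<close> is excluded: it can be arbitrarily small.\<close>

lemma admissible_on_gap:
  assumes "admissible_on X \<phi> A \<tau>"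
  obtains \<gamma> where "0 < \<gamma>"
    and "\<And>x i j. x \<in> X \<Longrightarrow> i \<in> A x \<Longrightarrow> j \<in> A x \<Longrightarrow> 1 \<le> i \<Longrightarrow> i < j \<Longrightarrow> \<gamma> \<le> \<tau> x j - \<tau> x i"
proof -
  from assms obtain Z \<gamma> where ts: "time_sequences X A \<tau>" and \<gamma>: "0 < \<gamma>"
    and step: "\<And>x n. x \<in> X \<Longrightarrow> 1 \<le> n \<Longrightarrow> n + 1 \<in> A x \<Longrightarrow> \<gamma> \<le> \<tau> x (n + 1) - \<tau> x n"
    unfolding admissible_on_def admissible_wrt_def by blast
  have "\<gamma> \<le> \<tau> x j - \<tau> x i"
    if x: "x \<in> X" and i: "i \<in> A x" and j: "j \<in> A x" and "1 \<le> i" "i < j" for x i j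
  proof -
    have mono: "strict_mono_on (A x) (\<tau> x)"
      using ts x by (auto simp: time_sequences_def)
    \<comment> \<open>Index sets are initial segments or all of the naturals, so they contain every
      index below \<open>j\<close>.\<close>
    have i': "i + 1 \<in> A x"
      using ts x j \<open>i < j\<close> by (fastforce simp: time_sequences_def)
    have "\<tau> x (i + 1) \<le> \<tau> x j"
      using strict_mono_on_leD[OF mono i' j] \<open>i < j\<close> by simp
    then show ?thesis
      using step[OF x \<open>1 \<le> i\<close> i'] by simp
  qed
  with \<gamma> show ?thesis
    using that by blast
qed

text \<open>Pigeonhole on three times: \<open>4 * \<rho> < \<delta>\<close> keeps them in the
  window, and their spacing \<open>2 * \<rho>\<close> stops one open interval of radius
  \<open>\<rho>\<close> from containing two of them.\<close>

lemma tau_times_meets_window: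
  assumes zero: "0 \<in> A x" "\<tau> x 0 = 0"
    and gap: "\<And>i j. i \<in> A x \<Longrightarrow> j \<in> A x \<Longrightarrow> 1 \<le> i \<Longrightarrow> i < j \<Longrightarrow> \<gamma> \<le> \<tau> x j - \<tau> x i"
    and \<rho>: "0 < \<rho>" "6 * \<rho> \<le> \<gamma>" "4 * \<rho> < \<delta>"
    and t: "0 \<le> t" "t \<le> T"
  shows "\<exists>s\<in>{0..<\<delta>}. s + t \<in> tau_times A \<tau> (T + \<delta>) \<rho> x"
proof (rule ccontr)
  assume none: "\<not> ?thesis"
  \<comment> \<open>Time 0 lies outside \<open>{0<..T + \<delta>}\<close>, but the interval around
    \<open>\<tau> x 0\<close> catches it.\<close>
  have hit: "\<exists>j\<in>A x. \<bar>t + s - \<tau> x j\<bar> < \<rho>" if "0 \<le> s" "s \<le> 4 * \<rho>" for s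
  proof (cases "s + t = 0")
    case True
    then show ?thesis
      using zero \<rho> by (intro bexI[of _ 0]) auto
  next
    case False
    have "s + t \<notin> tau_times A \<tau> (T + \<delta>) \<rho> x"
      using none that \<rho> by auto
    moreover have "s + t \<in> {0<..T + \<delta>}"
      using False that t \<rho> by auto
    ultimately obtain j where "j \<in> A x" "s + t \<in> {\<tau> x j - \<rho> <..< \<tau> x j + \<rho>}"
      unfolding tau_times_def by blast
    then show ?thesis
      by (intro bexI[of _ j]) (auto simp: abs_less_iff)
  qed
  obtain i j k where ijk: "i \<in> A x" "j \<in> A x" "k \<in> A x"
    and near: "\<bar>t + 0 - \<tau> x i\<bar> < \<rho>" "\<bar>t + 2 * \<rho> - \<tau> x j\<bar> < \<rho>" "\<bar>t + 4 * \<rho> - \<tau> x k\<bar> < \<rho>"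
    using hit[of 0] hit[of "2 * \<rho>"] hit[of "4 * \<rho>"] \<rho> by auto
  \<comment> \<open>Test times are at most \<open>4 * \<rho>\<close> apart and each centre is within
    \<open>\<rho>\<close> of its own, which gives the bound \<open>6 * \<rho>\<close>.\<close>
  have close: "m = 0 \<or> n = 0 \<or> m = n"
    if "m \<in> A x" "n \<in> A x" "\<bar>\<tau> x m - \<tau> x n\<bar> < 6 * \<rho>" for m n
    using gap[of m n] gap[of n m] that \<rho> by (cases m n rule: linorder_cases; fastforce)
  have "i \<noteq> j" "j \<noteq> k" "i \<noteq> k"
    using near by auto
  moreover have "i = 0 \<or> j = 0 \<or> i = j" "j = 0 \<or> k = 0 \<or> j = k" "i = 0 \<or> k = 0 \<or> i = k"
    using near ijk \<rho> by (intro close; auto)+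
  \<comment> \<open>At most one of three distinct indices is 0; the other two contradict the
    alternatives.\<close>
  ultimately show False
    by auto
qed

section \<open>Comparison of the two kinds of separated sets\<close>

lemma hat_s_le_tau_s:
  assumes flow: "semiflow_on X \<phi>" and ts: "time_sequences X A \<tau>"
    and gap: "\<And>x i j. x \<in> X \<Longrightarrow> i \<in> A x \<Longrightarrow> j \<in> A x \<Longrightarrow> 1 \<le> i \<Longrightarrow> i < j \<Longrightarrow> \<gamma> \<le> \<tau> x j - \<tau> x i"
    and \<rho>: "0 < \<rho>" "6 * \<rho> \<le> \<gamma>" "4 * \<rho> < \<delta>"
    and \<epsilon>: "0 < \<epsilon>"
  shows "hat_s X \<phi> T \<epsilon> \<delta> \<le> tau_s X \<phi> A \<tau> (T + \<delta>) \<epsilon> \<rho>"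
proof -
  have \<delta>: "0 < \<delta>"
    using \<rho> by linarith
  \<comment> \<open>Separation by the larger balls implies separation by the smaller ones. The
    horizon \<open>T + \<delta>\<close> makes room for \<open>s + t\<close> with
    \<open>s < \<delta>\<close>.\<close>
  have ball: "tau_ball X \<phi> A \<tau> (T + \<delta>) \<epsilon> \<rho> x \<subseteq> hat_ball X \<phi> T \<epsilon> \<delta> x" if x: "x \<in> X" for x
  proof
    fix y assume y: "y \<in> tau_ball X \<phi> A \<tau> (T + \<delta>) \<epsilon> \<rho> x"
    have yX: "y \<in> X"
      using y by (simp add: tau_ball_def)
    have "dist_delta \<phi> \<delta> (\<phi> t x) (\<phi> t y) < \<epsilon>" if t: "t \<in> {0..T}" for t
    proof -
      have "0 \<in> A x" "\<tau> x 0 = 0"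
        using ts x by (auto simp: time_sequences_def)
      then obtain s where s: "s \<in> {0..<\<delta>}" "s + t \<in> tau_times A \<tau> (T + \<delta>) \<rho> x"
        using tau_times_meets_window[of A x \<tau> \<gamma> \<rho> \<delta> t T] gap[OF x] \<rho> t by auto
      have "dist_delta \<phi> \<delta> (\<phi> t x) (\<phi> t y) \<le> dist (\<phi> s (\<phi> t x)) (\<phi> s (\<phi> t y))"
        using s by (intro dist_delta_le)
      also have "\<dots> = dist (\<phi> (s + t) x) (\<phi> (s + t) y)"
        using flow s t x yX by (simp add: semiflow_on_def)
      also have "\<dots> < \<epsilon>"
        using y s by (simp add: tau_ball_def)
      finally show ?thesis .
    qed
    with yX show "y \<in> hat_ball X \<phi> T \<epsilon> \<delta> x"
      by (simp add: hat_ball_def)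
  qed
  show ?thesis
    unfolding hat_s_def
  proof (rule SUP_least)
    fix E assume "E \<in> {E. hat_separated X \<phi> T \<epsilon> \<delta> E}"
    then have E: "hat_separated X \<phi> T \<epsilon> \<delta> E"
      by simp
    \<comment> \<open>Finiteness is part of \<open>tau_separated\<close>, so a possibly infinite
      \<open>E\<close> is measured through its finite subsets.\<close>
    have "ecard F \<le> tau_s X \<phi> A \<tau> (T + \<delta>) \<epsilon> \<rho>" if "F \<subseteq> E" "finite F" for F
    proof -
      have "E \<subseteq> X" "\<forall>x\<in>E. \<forall>y\<in>E. x \<noteq> y \<longrightarrow> y \<notin> hat_ball X \<phi> T \<epsilon> \<delta> x"
        using E by (auto simp: hat_separated_iff[OF \<epsilon> \<delta>])
      with that have "tau_separated X \<phi> A \<tau> (T + \<delta>) \<epsilon> \<rho> F"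
        unfolding tau_separated_iff[OF \<epsilon>] by (meson ball subset_iff)
      then show ?thesis
        unfolding tau_s_def by (intro SUP_upper) auto
    qed
    then show "ecard E \<le> tau_s X \<phi> A \<tau> (T + \<delta>) \<epsilon> \<rho>"
      by (subst ecard_le_iff_finite_subsets) blast
  qed
qed

theorem theorem2:
  fixes X :: "'a::metric_space set"
    and \<phi> :: "real \<Rightarrow> 'a \<Rightarrow> 'a"
    and A :: "'a \<Rightarrow> nat set"
    and \<tau> :: "'a \<Rightarrow> nat \<Rightarrow> real"
  assumes "compact X"
    and "semiflow_on X \<phi>"
    and "admissible_on X \<phi> A \<tau>"
  shows "hat_h_r X \<phi> \<le> hat_h_s X \<phi> \<and> hat_h_s X \<phi> \<le> h_tau X \<phi> A \<tau>"
proof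
  show "hat_h_r X \<phi> \<le> hat_h_s X \<phi>"
    unfolding hat_h_r_eq_SUP hat_h_s_eq_SUP
    by (intro SUP_subset_mono subset_refl growth_rate_mono hat_r_le_hat_s) auto
next
  obtain \<gamma> where \<gamma>: "0 < \<gamma>"
    and gap: "\<And>x i j. x \<in> X \<Longrightarrow> i \<in> A x \<Longrightarrow> j \<in> A x \<Longrightarrow> 1 \<le> i \<Longrightarrow> i < j \<Longrightarrow> \<gamma> \<le> \<tau> x j - \<tau> x i"
    using admissible_on_gap[OF assms(3)] by blast
  have ts: "time_sequences X A \<tau>"
    using assms(3) by (auto simp: admissible_on_def admissible_wrt_def)
  show "hat_h_s X \<phi> \<le> h_tau X \<phi> A \<tau>"
    unfolding hat_h_s_eq_SUP h_tau_eq_SUP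
  proof (rule SUP_mono)
    fix \<delta> :: real assume "\<delta> \<in> {0<..}"
    then have \<delta>: "0 < \<delta>"
      by simp
    \<comment> \<open>Each \<open>\<delta>\<close> is matched with its own \<open>\<rho>\<close>.
      The choice is independent of \<open>\<epsilon>\<close>, so the inner suprema are compared at
      equal \<open>\<epsilon>\<close>.\<close>
    define \<rho> where "\<rho> = min \<delta> \<gamma> / 6"
    have \<rho>: "0 < \<rho>" "6 * \<rho> \<le> \<gamma>" "4 * \<rho> < \<delta>"
      using \<delta> \<gamma> by (auto simp: \<rho>_def)
    have "growth_rate (\<lambda>T. hat_s X \<phi> T \<epsilon> \<delta>) \<le> growth_rate (\<lambda>T. tau_s X \<phi> A \<tau> T \<epsilon> \<rho>)"
      if "0 < \<epsilon>" for \<epsilon>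
      using \<delta> hat_s_le_tau_s[OF assms(2) ts gap \<rho> that] by (intro growth_rate_shift[of \<delta>]) auto
    then show "\<exists>\<rho>\<in>{0<..}. (SUP \<epsilon>\<in>{0<..}. growth_rate (\<lambda>T. hat_s X \<phi> T \<epsilon> \<delta>))
        \<le> (SUP \<epsilon>\<in>{0<..}. growth_rate (\<lambda>T. tau_s X \<phi> A \<tau> T \<epsilon> \<rho>))"
      using \<rho> by (intro bexI[of _ \<rho>] SUP_subset_mono) auto
  qed
qed

end
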